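(* For every positive integer $n$, \[ M(3, n) = \begin{cases} 5 & \text{if } n = 3, \\ \lfloor n/3\rfloor & \text{if } n\equiv 0\pmod 3,\ n\neq 3,\\ \lfloor n/3\rfloor + 3 & \text{if } n\equiv 1\pmod 3,\\ \lfloor n/3\rfloor + 2 & \text{if } n\equiv 2\pmod 3. \end{cases} \]
   Context: The $T$-tetromino is the polyomino formed by four unit squares: three in a row together with a fourth square attached to the middle square of that row. A tiling of an $m\times n$ rectangle (of unit cells) by $T$-tetrominos and monominos is a partition of its cells into copies of the $T$-tetromino (in any rotation or reflection, aligned with the grid) and single cells (monominos). The gap number $M(m,n)$ is the least number of monominos occurring in such a tiling of the $m\times n$ rectangle. *)

theory Defs
  imports Complex_Main "HOL-Library.Disjoint_Sets"
begin

text \<open>A unit cell of the grid is identified with its integer (row, column) coordinates.\<close>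

type_synonym cell = "int \<times> int"

definition T_shape :: "cell set" where
  "T_shape = {(0,0), (0,1), (0,2), (1,1)}"

text \<open>All images of the T-tetromino under the symmetry group of the grid, which is generated by
  the quarter turn, one reflection and the translations.\<close>

inductive_set T_tetrominoes :: "cell set set" where
  shape: "T_shape \<in> T_tetrominoes"
| rotate: "X \<in> T_tetrominoes \<Longrightarrow> (\<lambda>(x, y). (- y, x)) ` X \<in> T_tetrominoes"
| reflect: "X \<in> T_tetrominoes \<Longrightarrow> (\<lambda>(x, y). (- x, y)) ` X \<in> T_tetrominoes"
| translate: "X \<in> T_tetrominoes \<Longrightarrow> (\<lambda>(x, y). (x + a, y + b)) ` X \<in> T_tetrominoes"

definition monominoes :: "cell set set" where
  "monominoes = {{c} | c. True}"

definition rectangle :: "nat \<Rightarrow> nat \<Rightarrow> cell set" where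
  "rectangle m n = {0..<int m} \<times> {0..<int n}"

definition is_tiling :: "nat \<Rightarrow> nat \<Rightarrow> cell set set \<Rightarrow> bool" where
  "is_tiling m n P \<longleftrightarrow> partition_on (rectangle m n) P \<and> P \<subseteq> T_tetrominoes \<union> monominoes"

definition gap_number :: "nat \<Rightarrow> nat \<Rightarrow> nat" where
  "gap_number m n = (LEAST k. \<exists>P. is_tiling m n P \<and> card (P \<inter> monominoes) = k)"

text \<open>The minimum in \<^const>\<open>gap_number\<close> is over a nonempty set, and the two kinds of
  tiles are distinct.\<close>

lemma ex_tiling: "\<exists>P. is_tiling m n P"
proof -
  have "is_tiling m n ((\<lambda>c. {c}) ` rectangle m n)"
    by (auto simp: is_tiling_def partition_on_def disjoint_def monominoes_def)
  then show ?thesis by blast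
qed

lemma card_T_tetromino: "X \<in> T_tetrominoes \<Longrightarrow> card X = 4"
proof (induction rule: T_tetrominoes.induct)
  case shape
  show ?case by (simp add: T_shape_def)
qed (subst card_image; auto simp: inj_on_def)+

lemma T_tetromino_not_monomino: "T_tetrominoes \<inter> monominoes = {}"
  using card_T_tetromino by (force simp: monominoes_def)

end

theory Submission
  imports Defs
begin

text \<open>Minimizing the number of monominoes means maximizing the number of T-tetrominoes. Say that
  a T-tetromino is centred in the column that contains at least two of its cells. It has at most
  one cell in either adjacent column, and counting cells column by column shows that in a strip of
  three rows three consecutive columns are never all centre columns. An upright T-tetromino can be
  attached to each end of the rectangle, pointing outwards, so the columns \<open>- 1\<close> and \<open>n\<close> may be
  counted as centre columns as well. Hence at most \<open>\<lfloor>2 * n / 3\<rfloor>\<close> T-tetrominoes fit. For \<open>n \<noteq> 3\<close>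
  this many are attained by a chain of interlocking pieces; for \<open>n = 3\<close> any T-tetromino covers the
  middle cell, so that only one fits.\<close>

subsection \<open>T-tetrominoes as neighbourhoods of their centres\<close>

fun neighbours :: "cell \<Rightarrow> cell set" where
  "neighbours (x, y) = {(x - 1, y), (x + 1, y), (x, y - 1), (x, y + 1)}"

definition T_tile :: "cell \<Rightarrow> cell \<Rightarrow> cell set" where
  "T_tile p q = insert p (neighbours p - {q})"

lemma image_T_tile:
  assumes "inj f" "f ` neighbours p = neighbours (f p)"
  shows "f ` T_tile p q = T_tile (f p) (f q)"
  using assms by (simp add: T_tile_def image_set_diff)

lemma rotate_T_tile:
  "(\<lambda>(x, y). (- y, x)) ` T_tile (x, y) (x', y') = T_tile (- y, x) (- y', x')"
  by (subst image_T_tile) (auto simp: inj_def)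

lemma translate_T_tile:
  "(\<lambda>(x, y). (x + a, y + b)) ` T_tile (x, y) (x', y') = T_tile (x + a, y + b) (x' + a, y' + b)"
  by (subst image_T_tile) (auto simp: inj_def)

lemma T_shape_eq_T_tile: "T_shape = T_tile (0, 1) (- 1, 1)"
  by (auto simp: T_shape_def T_tile_def)

lemma T_tetromino_imp_T_tile:
  assumes "X \<in> T_tetrominoes"
  obtains x y q where "q \<in> neighbours (x, y)" "X = T_tile (x, y) q"
proof -
  have symmetry: "\<exists>p. \<exists>q\<in>neighbours p. f ` Y = T_tile p q"
    if "\<exists>p. \<exists>q\<in>neighbours p. Y = T_tile p q" "inj f" "\<And>p. f ` neighbours p = neighbours (f p)"
    for f Y
    using that by (metis image_T_tile imageI)
  have "\<exists>p. \<exists>q\<in>neighbours p. X = T_tile p q"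
    using assms
  proof (induction rule: T_tetrominoes.induct)
    case shape
    have "(- 1, 1) \<in> neighbours (0, 1)"
      by simp
    with T_shape_eq_T_tile show ?case
      by blast
  next
    case (rotate X)
    show ?case
      by (rule symmetry[OF rotate.IH]) (auto simp: inj_def)
  next
    case (reflect X)
    show ?case
      by (rule symmetry[OF reflect.IH]) (auto simp: inj_def)
  next
    case (translate X a b)
    show ?case
      by (rule symmetry[OF translate.IH]) (auto simp: inj_def)
  qed
  then show thesis
    using that by force
qed

lemma T_tile_in_T_tetrominoes:
  assumes "q \<in> neighbours p"
  shows "T_tile p q \<in> T_tetrominoes"
proof -
  have rotated: "T_tile (0, 0) (- b, a) \<in> T_tetrominoes"
    if "T_tile (0, 0) (a, b) \<in> T_tetrominoes" for a b
    using T_tetrominoes.rotate[OF that] by (simp add: rotate_T_tile)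
  have translated: "T_tile (x + a, y + b) (x' + a, y' + b) \<in> T_tetrominoes"
    if "T_tile (x, y) (x', y') \<in> T_tetrominoes" for x y x' y' a b
    using T_tetrominoes.translate[OF that] by (simp only: translate_T_tile)
  have up: "T_tile (0, 0) (- 1, 0) \<in> T_tetrominoes"
    using T_tetrominoes.shape translated[of 0 1 "- 1" 1 0 "- 1"] by (simp add: T_shape_eq_T_tile)
  have left: "T_tile (0, 0) (0, - 1) \<in> T_tetrominoes"
    using rotated[OF up] by simp
  have down: "T_tile (0, 0) (1, 0) \<in> T_tetrominoes"
    using rotated[OF left] by simp
  have right: "T_tile (0, 0) (0, 1) \<in> T_tetrominoes"
    using rotated[OF down] by simp
  obtain x y where p_eq: "p = (x, y)"
    by fastforce
  show ?thesis
    using assms translated[OF up, of x y] translated[OF left, of x y]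
      translated[OF down, of x y] translated[OF right, of x y] by (auto simp: p_eq add.commute)
qed

subsection \<open>Packings and the gap number\<close>

definition T_packing :: "cell set \<Rightarrow> cell set set \<Rightarrow> bool" where
  "T_packing A F \<longleftrightarrow> finite F \<and> F \<subseteq> T_tetrominoes \<and> disjoint F \<and> \<Union>F \<subseteq> A"

lemma T_packing_mono: "T_packing A F \<Longrightarrow> A \<subseteq> B \<Longrightarrow> T_packing B F"
  by (auto simp: T_packing_def)

lemma T_packing_disjointD: "T_packing A F \<Longrightarrow> X \<in> F \<Longrightarrow> Y \<in> F \<Longrightarrow> X \<noteq> Y \<Longrightarrow> X \<inter> Y = {}"
  by (auto simp: T_packing_def disjoint_def)

lemma T_packing_insert:
  assumes "T_packing A F" "X \<in> T_tetrominoes" "X \<inter> A = {}"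
  shows "T_packing (A \<union> X) (insert X F)" "card (insert X F) = Suc (card F)"
proof -
  have disj: "X \<inter> Y = {}" if "Y \<in> F" for Y
    using assms that by (auto simp: T_packing_def)
  then show "T_packing (A \<union> X) (insert X F)"
    using assms by (auto simp: T_packing_def disjoint_def)
  have "X \<noteq> {}"
    using card_T_tetromino[OF assms(2)] by auto
  then have "X \<notin> F"
    using disj by blast
  then show "card (insert X F) = Suc (card F)"
    using assms(1) by (simp add: T_packing_def)
qed

lemma card_Union_T_packing:
  assumes "T_packing A F"
  shows "card (\<Union>F) = 4 * card F"
proof -
  have card_tile: "card X = 4" if "X \<in> F" for X
    using assms that card_T_tetromino by (auto simp: T_packing_def)
  have "card (\<Union>F) = (\<Sum>X\<in>F. card X)"
    using assms by (intro card_Union_disjoint card_ge_0_finite) (auto simp: T_packing_def card_tile)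
  then show ?thesis
    by (simp add: card_tile)
qed

lemma finite_rectangle: "finite (rectangle m n)"
  by (simp add: rectangle_def)

lemma card_rectangle: "card (rectangle m n) = m * n"
  by (simp add: rectangle_def card_cartesian_product)

lemma card_uncovered_cells:
  assumes "T_packing (rectangle m n) F"
  shows "card ((\<lambda>c. {c}) ` (rectangle m n - \<Union>F)) = m * n - 4 * card F"
proof -
  have "\<Union>F \<subseteq> rectangle m n"
    using assms by (simp add: T_packing_def)
  then show ?thesis
    using card_Union_T_packing[OF assms] finite_subset[OF _ finite_rectangle]
    by (simp add: card_image card_Diff_subset card_rectangle)
qed

lemma T_packing_tiling:
  assumes "is_tiling m n P"
  shows "T_packing (rectangle m n) (P \<inter> T_tetrominoes)"
proof -
  have "\<Union>P = rectangle m n" "disjoint P"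
    using assms by (auto simp: is_tiling_def partition_on_def)
  moreover from this have "finite P"
    using finite_rectangle finite_UnionD by metis
  ultimately show ?thesis
    by (auto simp: T_packing_def disjoint_def)
qed

lemma monominoes_of_tiling:
  assumes "is_tiling m n P"
  shows "P \<inter> monominoes = (\<lambda>c. {c}) ` (rectangle m n - \<Union>(P \<inter> T_tetrominoes))"
proof -
  have tiling: "\<Union>P = rectangle m n" "disjoint P" "P \<subseteq> T_tetrominoes \<union> monominoes"
    using assms by (auto simp: is_tiling_def partition_on_def)
  show ?thesis
  proof (intro equalityI subsetI)
    fix X assume mono: "X \<in> P \<inter> monominoes"
    then obtain c where X_eq: "X = {c}"
      by (auto simp: monominoes_def)
    have "c \<notin> Y" if "Y \<in> P \<inter> T_tetrominoes" for Y
    proof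
      assume "c \<in> Y"
      then have "X = Y"
        using mono X_eq that tiling(2) by (metis IntD1 disjointD disjoint_iff singletonI)
      then show False
        using mono that T_tetromino_not_monomino by blast
    qed
    then show "X \<in> (\<lambda>c. {c}) ` (rectangle m n - \<Union>(P \<inter> T_tetrominoes))"
      using mono X_eq tiling(1) by blast
  next
    fix X assume "X \<in> (\<lambda>c. {c}) ` (rectangle m n - \<Union>(P \<inter> T_tetrominoes))"
    then obtain c Y where "X = {c}" "c \<in> Y" "Y \<in> P" "Y \<notin> T_tetrominoes"
      using tiling(1) by blast
    moreover from this have "Y \<in> monominoes"
      using tiling(3) by blast
    ultimately show "X \<in> P \<inter> monominoes"
      by (auto simp: monominoes_def)
  qed
qed

lemma T_packing_imp_tiling:
  assumes "T_packing (rectangle m n) F"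
  obtains P where "is_tiling m n P" "P \<inter> T_tetrominoes = F"
proof
  let ?P = "F \<union> (\<lambda>c. {c}) ` (rectangle m n - \<Union>F)"
  have packing: "F \<subseteq> T_tetrominoes" "disjoint F" "\<Union>F \<subseteq> rectangle m n"
    using assms by (auto simp: T_packing_def)
  have "{} \<notin> T_tetrominoes"
    using card_T_tetromino by fastforce
  then show "is_tiling m n ?P"
    using packing by (auto simp: is_tiling_def partition_on_def disjoint_def monominoes_def)
  show "?P \<inter> T_tetrominoes = F"
    using packing T_tetromino_not_monomino by (auto simp: monominoes_def)
qed

lemma gap_number_eq:
  assumes "T_packing (rectangle m n) F"
    and max: "\<And>G. T_packing (rectangle m n) G \<Longrightarrow> card G \<le> card F"
  shows "gap_number m n = m * n - 4 * card F"
proof -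
  have card_gaps: "card (P \<inter> monominoes) = m * n - 4 * card (P \<inter> T_tetrominoes)"
    if "is_tiling m n P" for P
    using that by (simp add: monominoes_of_tiling card_uncovered_cells T_packing_tiling)
  show ?thesis
    unfolding gap_number_def
  proof (rule Least_equality)
    show "\<exists>P. is_tiling m n P \<and> card (P \<inter> monominoes) = m * n - 4 * card F"
      using T_packing_imp_tiling[OF assms(1)] card_gaps by metis
    show "m * n - 4 * card F \<le> k" if "\<exists>P. is_tiling m n P \<and> card (P \<inter> monominoes) = k" for k
      using that card_gaps max T_packing_tiling by (metis diff_le_mono2 mult_le_mono2)
  qed
qed

subsection \<open>Centre columns\<close>

definition column_card :: "cell set \<Rightarrow> int \<Rightarrow> nat" where
  "column_card X y = card {x. (x, y) \<in> X}"

definition centre_column :: "cell set \<Rightarrow> int" where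
  "centre_column X = (THE y. 2 \<le> column_card X y)"

lemma column_card_T_tile_off_centre:
  assumes "y' \<noteq> y"
  shows "column_card (T_tile (x, y) q) y' \<le> 1"
proof -
  have "{x'. (x', y') \<in> T_tile (x, y) q} \<subseteq> {x}"
    using assms by (auto simp: T_tile_def)
  then show ?thesis
    unfolding column_card_def using card_mono[of "{x}"] by simp
qed

lemma column_card_T_tile_sum:
  assumes "q \<in> neighbours (x, y)"
  shows "column_card (T_tile (x, y) q) (y - 1) + column_card (T_tile (x, y) q) y
    + column_card (T_tile (x, y) q) (y + 1) = 4"
  using assms by (auto simp: column_card_def T_tile_def insert_Diff_if Collect_disj_eq)

lemma centre_column_T_tile:
  assumes "q \<in> neighbours (x, y)"
  shows "centre_column (T_tile (x, y) q) = y"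
  unfolding centre_column_def
proof (rule the_equality)
  show "2 \<le> column_card (T_tile (x, y) q) y"
    using column_card_T_tile_sum[OF assms] column_card_T_tile_off_centre[of "y - 1" y x q]
      column_card_T_tile_off_centre[of "y + 1" y x q] by simp
  show "y' = y" if "2 \<le> column_card (T_tile (x, y) q) y'" for y'
    using that column_card_T_tile_off_centre[of y' y x q] by force
qed

lemma column_card_T_tetromino:
  assumes "X \<in> T_tetrominoes"
  defines "y \<equiv> centre_column X"
  shows "column_card X (y - 1) + column_card X y + column_card X (y + 1) = 4"
    and "column_card X (y - 1) \<le> 1" "column_card X (y + 1) \<le> 1"
proof -
  from assms(1) obtain x z q where nb: "q \<in> neighbours (x, z)" and X_eq: "X = T_tile (x, z) q"
    by (rule T_tetromino_imp_T_tile)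
  then have "y = z"
    by (simp add: y_def centre_column_T_tile)
  with X_eq show "column_card X (y - 1) + column_card X y + column_card X (y + 1) = 4"
    and "column_card X (y - 1) \<le> 1" "column_card X (y + 1) \<le> 1"
    using column_card_T_tile_sum[OF nb] column_card_T_tile_off_centre by simp_all
qed

lemma centre_column_in_rectangle:
  assumes "X \<in> T_tetrominoes" "X \<subseteq> rectangle m n"
  shows "centre_column X \<in> {0..<int n}"
proof -
  have "column_card X (centre_column X) \<noteq> 0"
    using column_card_T_tetromino[OF assms(1)] by linarith
  then obtain x where "(x, centre_column X) \<in> X"
    unfolding column_card_def by (metis (mono_tags, lifting) card.empty empty_Collect_eq)
  then show ?thesis
    using assms(2) by (auto simp: rectangle_def)
qed

definition strip :: "nat \<Rightarrow> cell set" where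
  "strip m = {0..<int m} \<times> UNIV"

lemma sum_column_card_le:
  assumes packing: "T_packing (strip m) F" and "G \<subseteq> F"
  shows "(\<Sum>X\<in>G. column_card X y) \<le> m"
proof -
  have "finite G"
    using packing \<open>G \<subseteq> F\<close> finite_subset by (auto simp: T_packing_def)
  have column: "{x. (x, y) \<in> X} \<subseteq> {0..<int m}" if "X \<in> G" for X
    using packing \<open>G \<subseteq> F\<close> that by (fastforce simp: T_packing_def strip_def)
  have "(\<Sum>X\<in>G. column_card X y) = card (\<Union>X\<in>G. {x. (x, y) \<in> X})"
    unfolding column_card_def
  proof (rule card_UN_disjoint[symmetric])
    show "finite G" by fact
    show "\<forall>X\<in>G. finite {x. (x, y) \<in> X}"
      using column finite_subset by blast
    show "\<forall>X\<in>G. \<forall>Y\<in>G. X \<noteq> Y \<longrightarrow> {x. (x, y) \<in> X} \<inter> {x. (x, y) \<in> Y} = {}"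
      using T_packing_disjointD[OF packing] \<open>G \<subseteq> F\<close> by blast
  qed
  also have "\<dots> \<le> card {0..<int m}"
    using column by (intro card_mono) auto
  finally show ?thesis
    by simp
qed

lemma inj_on_centre_column:
  assumes packing: "T_packing (strip 3) F"
  shows "inj_on centre_column F"
proof (rule inj_onI, rule ccontr)
  fix X Y assume tiles: "X \<in> F" "Y \<in> F" "centre_column X = centre_column Y" "X \<noteq> Y"
  then have "X \<in> T_tetrominoes" "Y \<in> T_tetrominoes"
    using packing by (auto simp: T_packing_def)
  then have "2 \<le> column_card X (centre_column X)" "2 \<le> column_card Y (centre_column X)"
    using column_card_T_tetromino[of X] column_card_T_tetromino[of Y] tiles(3) by simp_all
  moreover have "column_card X (centre_column X) + column_card Y (centre_column X) \<le> 3"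
    using sum_column_card_le[OF packing, of "{X, Y}" "centre_column X"] tiles by simp
  ultimately show False
    by linarith
qed

lemma no_three_consecutive_centre_columns:
  assumes packing: "T_packing (strip 3) F"
  shows "\<not> {y..<y + 3} \<subseteq> centre_column ` F"
proof
  assume "{y..<y + 3} \<subseteq> centre_column ` F"
  then have "y \<in> centre_column ` F" "y + 1 \<in> centre_column ` F" "y + 2 \<in> centre_column ` F"
    by auto
  then obtain X Y Z where in_F: "X \<in> F" "Y \<in> F" "Z \<in> F"
    and columns: "centre_column X = y" "centre_column Y = y + 1" "centre_column Z = y + 2"
    by auto
  have "X \<in> T_tetrominoes" "Y \<in> T_tetrominoes" "Z \<in> T_tetrominoes"
    using packing in_F by (auto simp: T_packing_def)
  note profiles = this[THEN column_card_T_tetromino(1)] this[THEN column_card_T_tetromino(2)]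
    this[THEN column_card_T_tetromino(3)]
  have "X \<noteq> Y" "Y \<noteq> Z" "X \<noteq> Z"
    using columns by auto
  then have capacity: "column_card X z + column_card Y z + column_card Z z \<le> 3" for z
    using sum_column_card_le[OF packing, of "{X, Y, Z}" z] in_F by simp
  have "column_card Y y \<le> column_card X (y + 1)"
    using profiles capacity[of y] columns by (simp add: algebra_simps)
  moreover have "column_card Y (y + 2) \<le> column_card Z (y + 1)"
    using profiles capacity[of "y + 2"] columns by (simp add: algebra_simps)
  ultimately show False
    using profiles capacity[of "y + 1"] columns by (simp add: algebra_simps)
qed

subsection \<open>The upper bound\<close>

lemma card_add_div_le_if_no_consecutive:
  fixes S :: "int set"
  assumes "S \<subseteq> {a..<a + int N}"
    and no_block: "\<And>c. \<not> {c..<c + int k} \<subseteq> S"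
  shows "card S + N div k \<le> N"
proof -
  let ?I = "{a..<a + int N}"
  have "\<forall>i. \<exists>g. g \<in> {a + int k * int i..<a + int k * int i + int k} - S"
    using no_block by blast
  then obtain g where g_in_block: "g i \<in> {a + int k * int i..<a + int k * int i + int k} - S" for i
    by metis
  have "(g i - a) div int k = int i" for i
    using g_in_block[of i] by (intro int_div_pos_eq[of _ _ _ "g i - a - int k * int i"]) auto
  then have "inj_on g {..<N div k}"
    by (metis inj_onI of_nat_eq_iff)
  moreover have "g ` {..<N div k} \<subseteq> ?I - S"
  proof (rule image_subsetI)
    fix i assume "i \<in> {..<N div k}"
    then have "k * (i + 1) \<le> k * (N div k)"
      by (intro mult_le_mono2) simp
    also have "\<dots> \<le> N"
      by simp
    finally have "int k * int i + int k \<le> int N"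
      by (simp flip: of_nat_mult of_nat_add)
    moreover have "0 \<le> int k * int i"
      by simp
    moreover have "a + int k * int i \<le> g i" "g i < a + int k * int i + int k" "g i \<notin> S"
      using g_in_block[of i] by simp_all
    ultimately have "a \<le> g i" "g i < a + int N"
      by linarith+
    with \<open>g i \<notin> S\<close> show "g i \<in> ?I - S"
      by simp
  qed
  ultimately have "N div k \<le> card (?I - S)"
    using card_inj_on_le by fastforce
  also have "\<dots> = N - card S"
    using assms(1) finite_subset by (subst card_Diff_subset) auto
  finally show ?thesis
    using card_mono[OF _ assms(1)] by simp
qed

lemma card_T_packing_strip:
  assumes packing: "T_packing (strip 3) F" and "centre_column ` F \<subseteq> {a..<a + int N}"
  shows "card F + N div 3 \<le> N"
proof -
  have "card (centre_column ` F) + N div 3 \<le> N"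
    using assms(2) no_three_consecutive_centre_columns[OF packing]
    by (intro card_add_div_le_if_no_consecutive) auto
  then show ?thesis
    by (simp add: card_image inj_on_centre_column[OF packing])
qed

lemma card_T_packing_rectangle_3:
  assumes packing: "T_packing (rectangle 3 n) F"
  shows "card F \<le> 2 * n div 3"
proof -
  let ?L = "T_tile (1, - 1) (1, 0)" and ?R = "T_tile (1, int n) (1, int n - 1)"
  have "?L \<in> T_tetrominoes" "?R \<in> T_tetrominoes"
    by (auto intro: T_tile_in_T_tetrominoes)
  moreover have "?L \<inter> rectangle 3 n = {}" "?R \<inter> (rectangle 3 n \<union> ?L) = {}"
    by (auto simp: T_tile_def insert_Diff_if rectangle_def)
  ultimately have "T_packing (rectangle 3 n \<union> ?L \<union> ?R) (insert ?R (insert ?L F))"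
    and card: "card (insert ?R (insert ?L F)) = card F + 2"
    using T_packing_insert[OF packing] T_packing_insert[of "rectangle 3 n \<union> ?L"] by simp_all
  moreover have "rectangle 3 n \<union> ?L \<union> ?R \<subseteq> strip 3"
    by (auto simp: T_tile_def insert_Diff_if rectangle_def strip_def)
  ultimately have "T_packing (strip 3) (insert ?R (insert ?L F))"
    using T_packing_mono by blast
  moreover have "centre_column ?L = - 1" "centre_column ?R = int n"
    by (simp_all add: centre_column_T_tile)
  moreover have "centre_column X \<in> {0..<int n}" if "X \<in> F" for X
    using packing that by (intro centre_column_in_rectangle) (auto simp: T_packing_def)
  ultimately have "card F + 2 + (n + 2) div 3 \<le> n + 2"
    using card_T_packing_strip[of "insert ?R (insert ?L F)" "- 1" "n + 2"]
    by (fastforce simp: card)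
  then show ?thesis
    by linarith
qed

lemma middle_in_T_tetromino:
  assumes "X \<in> T_tetrominoes" "X \<subseteq> rectangle 3 3"
  shows "(1, 1) \<in> X"
proof -
  from assms(1) obtain x y q where tile: "q \<in> neighbours (x, y)" "X = T_tile (x, y) q"
    by (rule T_tetromino_imp_T_tile)
  then show ?thesis
    using assms(2) unfolding neighbours.simps
    by (elim insertE emptyE) (simp_all add: T_tile_def insert_Diff_if rectangle_def, presburger+)
qed

lemma card_T_packing_rectangle_3_3:
  assumes packing: "T_packing (rectangle 3 3) F"
  shows "card F \<le> 1"
proof -
  have "(1, 1) \<in> X" if "X \<in> F" for X
    using packing that by (intro middle_in_T_tetromino) (auto simp: T_packing_def)
  then have "X = Y" if "X \<in> F" "Y \<in> F" for X Y
    using T_packing_disjointD[OF packing] that by blast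
  then show ?thesis
    using packing by (simp add: T_packing_def card_le_Suc0_iff_eq)
qed

subsection \<open>Optimal packings\<close>

text \<open>The \<open>3 \<times> 9\<close> rectangle, where \<open>m = 2\<close> pairs \<open>B C\<close> and \<open>D E\<close> are chained
  between the end pieces \<open>A\<close> and \<open>X\<close>:
  \<^verbatim>\<open>
    A B B B D D D . X
    A A B C . D E X X
    A . C C C E E E X
  \<close>
  The last piece before \<open>X\<close> reaches one cell of column \<open>3 * m + 1\<close>.\<close>

definition chain_region :: "nat \<Rightarrow> cell set" where
  "chain_region m = insert (if m = 0 then 1 else 2, 3 * int m + 1) (rectangle 3 (3 * m + 1))"

lemma ex_T_packing_chain_region: "\<exists>F. T_packing (chain_region m) F \<and> card F = 2 * m + 1"
proof (induction m)
  case 0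
  let ?A = "T_tile (1, 0) (1, - 1)"
  have "?A \<in> T_tetrominoes"
    by (auto intro: T_tile_in_T_tetrominoes)
  moreover have "?A \<subseteq> chain_region 0"
    by (auto simp: T_tile_def insert_Diff_if chain_region_def rectangle_def)
  ultimately have "T_packing (chain_region 0) {?A}"
    by (simp add: T_packing_def)
  then show ?case
    by (intro exI[of _ "{?A}"]) simp
next
  case (Suc m)
  then obtain F where chain: "T_packing (chain_region m) F" "card F = 2 * m + 1"
    by blast
  let ?B = "T_tile (0, 3 * int m + 2) (- 1, 3 * int m + 2)"
    and ?C = "T_tile (2, 3 * int m + 3) (3, 3 * int m + 3)"
  have "?B \<in> T_tetrominoes" "?C \<in> T_tetrominoes"
    by (auto intro: T_tile_in_T_tetrominoes)
  moreover have "?B \<inter> chain_region m = {}" "?C \<inter> (chain_region m \<union> ?B) = {}"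
    by (auto simp: T_tile_def insert_Diff_if chain_region_def rectangle_def)
  ultimately have "T_packing (chain_region m \<union> ?B \<union> ?C) (insert ?C (insert ?B F))"
    and "card (insert ?C (insert ?B F)) = 2 * Suc m + 1"
    using T_packing_insert[OF chain(1)] T_packing_insert[of "chain_region m \<union> ?B"] chain(2) by simp_all
  moreover have "chain_region m \<union> ?B \<union> ?C \<subseteq> chain_region (Suc m)"
    by (auto simp: T_tile_def insert_Diff_if chain_region_def rectangle_def)
  ultimately show ?case
    using T_packing_mono by blast
qed

lemma ex_T_packing_open_chain:
  assumes "3 * m + 2 \<le> n"
  shows "\<exists>F. T_packing (rectangle 3 n) F \<and> card F = 2 * m + 1"
proof -
  have "chain_region m \<subseteq> rectangle 3 n"
    using assms by (auto simp: chain_region_def rectangle_def)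
  then show ?thesis
    using ex_T_packing_chain_region T_packing_mono by blast
qed

lemma ex_T_packing_closed_chain:
  assumes "3 * m + 3 \<le> n" "n \<noteq> 3"
  shows "\<exists>F. T_packing (rectangle 3 n) F \<and> card F = 2 * m + 2"
proof -
  obtain F where chain: "T_packing (chain_region m) F" "card F = 2 * m + 1"
    using ex_T_packing_chain_region by blast
  let ?X = "T_tile (1, int n - 1) (1, int n)"
  have "?X \<in> T_tetrominoes"
    by (auto intro: T_tile_in_T_tetrominoes)
  moreover have "?X \<inter> chain_region m = {}"
    using assms by (auto simp: T_tile_def insert_Diff_if chain_region_def rectangle_def)
  ultimately have "T_packing (chain_region m \<union> ?X) (insert ?X F)" "card (insert ?X F) = 2 * m + 2"
    using T_packing_insert[OF chain(1)] chain(2) by simp_all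
  moreover have "chain_region m \<union> ?X \<subseteq> rectangle 3 n"
    using assms by (auto simp: T_tile_def insert_Diff_if chain_region_def rectangle_def)
  ultimately show ?thesis
    using T_packing_mono by blast
qed

lemma two_mult_div_3: "2 * n div 3 = 2 * (n div 3) + (if n mod 3 = 2 then 1 else 0)" for n :: nat
  by (cases "n mod 3 = 2"; simp; presburger)

lemma ex_T_packing_rectangle_3:
  assumes "n \<noteq> 3"
  shows "\<exists>F. T_packing (rectangle 3 n) F \<and> card F = 2 * n div 3"
proof -
  consider "n \<le> 1" | "n mod 3 = 2" | "n > 3" "n mod 3 \<noteq> 2"
    using assms by force
  then show ?thesis
  proof cases
    case 1
    then show ?thesis
      by (intro exI[of _ "{}"]) (simp add: T_packing_def)
  next
    case 2
    then have "3 * (n div 3) + 2 \<le> n"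
      by presburger
    moreover have "2 * (n div 3) + 1 = 2 * n div 3"
      using 2 by (simp add: two_mult_div_3)
    ultimately show ?thesis
      using ex_T_packing_open_chain by metis
  next
    case 3
    then have "3 * (n div 3 - 1) + 3 \<le> n"
      by linarith
    moreover have "2 * (n div 3 - 1) + 2 = 2 * n div 3"
      using 3 by (simp add: two_mult_div_3)
    ultimately show ?thesis
      using ex_T_packing_closed_chain assms by metis
  qed
qed

theorem theorem1:
  fixes n :: nat
  assumes "n > 0"
  shows "gap_number 3 n =
    (if n = 3 then 5
     else if n mod 3 = 0 then n div 3
     else if n mod 3 = 1 then n div 3 + 3
     else n div 3 + 2)"
proof (cases "n = 3")
  case True
  obtain F where "T_packing (rectangle 3 3) F" "card F = 1"
    using ex_T_packing_open_chain[of 0 3] by auto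
  then have "gap_number 3 3 = 3 * 3 - 4 * 1"
    using gap_number_eq card_T_packing_rectangle_3_3 by metis
  with True show ?thesis
    by simp
next
  case False
  then obtain F where "T_packing (rectangle 3 n) F" "card F = 2 * n div 3"
    using ex_T_packing_rectangle_3 by blast
  then have gap: "gap_number 3 n = 3 * n - 4 * (2 * n div 3)"
    using gap_number_eq card_T_packing_rectangle_3 by metis
  have "3 * n = 9 * (n div 3) + 3 * (n mod 3)"
    using mult_div_mod_eq[of 3 n] by linarith
  moreover have "n mod 3 = 0 \<or> n mod 3 = 1 \<or> n mod 3 = 2"
    by presburger
  ultimately have "3 * n - 4 * (2 * n div 3) =
    (if n mod 3 = 0 then n div 3 else if n mod 3 = 1 then n div 3 + 3 else n div 3 + 2)"
    unfolding two_mult_div_3 by auto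
  with gap False show ?thesis
    by simp
qed

end
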